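(* Let $\frac{a}{b}$ and $\frac{c}{d}$ be non-negative fractions in lowest terms (with $b,d>0$) satisfying $bc - ad = 1$. Then every rational number in the interval $\left[\frac{a}{b}, \frac{c}{d}\right]$ appears in the tree $T\left(\frac{a}{b}, \frac{c}{d}\right)$.
   Context: All fractions are written in lowest terms with positive denominator. The mediant of two reduced fractions $\frac{p}{q}$ and $\frac{r}{s}$ is the fraction $\frac{p+r}{q+s}$ put in lowest terms. Given two non-negative rational numbers $\frac{a}{b} < \frac{c}{d}$ in lowest terms, define finite sequences (rows) $S_n\left(\frac{a}{b},\frac{c}{d}\right)$, $n \ge 0$, of reduced fractions: $S_0 = \left(\frac{a}{b}, \frac{c}{d}\right)$, and $S_{n+1}$ is obtained from $S_n$ by copying all terms and inserting between every two consecutive terms their (reduced) mediant, where the mediant is computed from the reduced forms of the two terms. The tree $T\left(\frac{a}{b},\frac{c}{d}\right)$ is the collection of all the rows $S_n\left(\frac{a}{b},\frac{c}{d}\right)$, $n\ge 0$; a rational number appears in the tree if it is a term of some row. *)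

theory Defs
  imports Complex_Main
begin

text \<open>
  Values of type \<^typ>\<open>rat\<close> serve as fractions in lowest terms: the numerator and the
  positive denominator of the reduced form are the components of \<^const>\<open>quotient_of\<close>,
  and \<^const>\<open>Fract\<close> reduces its result.
\<close>

definition mediant :: "rat \<Rightarrow> rat \<Rightarrow> rat" where
  "mediant x y =
     (let (p, q) = quotient_of x; (r, s) = quotient_of y in Fract (p + r) (q + s))"

fun insert_mediants :: "rat list \<Rightarrow> rat list" where
  "insert_mediants [] = []"
| "insert_mediants [x] = [x]"
| "insert_mediants (x # y # zs) = x # mediant x y # insert_mediants (y # zs)"

primrec row :: "rat \<Rightarrow> rat \<Rightarrow> nat \<Rightarrow> rat list" where
  "row x y 0 = [x, y]"
| "row x y (Suc n) = insert_mediants (row x y n)"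

definition mediant_tree :: "rat \<Rightarrow> rat \<Rightarrow> rat list set" where
  "mediant_tree x y = range (row x y)"

definition appears_in :: "rat \<Rightarrow> rat list set \<Rightarrow> bool" where
  "appears_in t T \<longleftrightarrow> (\<exists>R\<in>T. t \<in> set R)"

end

theory Submission imports Defs begin

text \<open>
  If \<open>p/q\<close> lies strictly between neighbours \<open>a/b < c/d\<close> with \<open>bc - ad = 1\<close>, then
  \<open>q = b (cq - dp) + d (bp - aq) \<ge> b + d\<close>. The mediant splits such a pair into two
  pairs of the same kind with a larger sum of denominators, so the descent towards a
  given fraction must hit it after finitely many rows.
\<close>

lemma insert_mediants_Cons: "\<exists>ws. insert_mediants (v # vs) = v # ws"
  by (cases vs) auto

text \<open>Insertion acts locally, so the descent can follow one pair of neighbours whatever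
  surrounds it in the row.\<close>

lemma insert_mediants_neighbours:
  "\<exists>us' vs'. insert_mediants (us @ u # v # vs) = us' @ u # mediant u v # v # vs'"
proof (induction us)
  case Nil
  obtain ws where "insert_mediants (v # vs) = v # ws"
    using insert_mediants_Cons by blast
  then have "insert_mediants ([] @ u # v # vs) = [] @ u # mediant u v # v # ws"
    by simp
  then show ?case by blast
next
  case (Cons x us)
  then obtain us' vs'
    where IH: "insert_mediants (us @ u # v # vs) = us' @ u # mediant u v # v # vs'"
    by blast
  \<comment> \<open>Exposing a head after \<open>x\<close> lets the third equation of
    \<open>insert_mediants\<close> fire.\<close>
  obtain y ys where y: "us @ u # v # vs = y # ys"
    by (cases us) auto
  have "insert_mediants ((x # us) @ u # v # vs) = (x # mediant x y # us') @ u # mediant u v # v # vs'"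
    using IH y by simp
  then show ?case by blast
qed

text \<open>Coprimality makes \<open>quotient_of\<close> return the given numerators and
  denominators unchanged.\<close>

lemma mediant_Fract:
  assumes "b > 0" "d > 0" "coprime a b" "coprime c d"
  shows "mediant (Fract a b) (Fract c d) = Fract (a + c) (b + d)"
  using assms by (simp add: mediant_def quotient_of_Fract Rat.normalize_def coprime_iff_gcd_eq_1)

lemma denominator_between:
  fixes a b c d p q :: int
  assumes "b > 0" "d > 0" and det: "b * c - a * d = 1"
    and "a * q < p * b" "p * d < c * q"
  shows "b + d \<le> q"
proof -
  have "q = q * (b * c - a * d)"
    using det by simp
  also have "\<dots> = b * (c * q - p * d) + d * (p * b - a * q)"
    by (simp add: algebra_simps)
  \<comment> \<open>Both factors are positive integers, hence at least 1.\<close>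
  also have "\<dots> \<ge> b * 1 + d * 1"
    using assms by (intro add_mono mult_left_mono) auto
  finally show ?thesis by simp
qed

text \<open>A common divisor of either pair divides the determinant 1. Thus coprimality need not be
  carried through the induction.\<close>

lemma coprime_if_det_1:
  fixes a b c d :: int
  assumes "b * c - a * d = 1"
  shows "coprime a b" "coprime c d"
proof -
  show "coprime a b"
  proof (rule coprimeI)
    fix k assume "k dvd a" "k dvd b"
    then have "k dvd b * c - a * d" by simp
    then show "is_unit k" using assms by simp
  qed
  show "coprime c d"
  proof (rule coprimeI)
    fix k assume "k dvd c" "k dvd d"
    then have "k dvd b * c - a * d" by simp
    then show "is_unit k" using assms by simp
  qed
qed

text \<open>The pair, the row index and the surrounding \<open>us\<close>, \<open>vs\<close> are
  generalised, so that the induction hypothesis applies to either half of the split pair in the next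
  row.\<close>

lemma appears_between_neighbours:
  fixes a b c d p q :: int
  assumes "b > 0" "d > 0" "q > 0" "b * c - a * d = 1"
    and "row x y n = us @ Fract a b # Fract c d # vs"
    and "Fract a b \<le> Fract p q" "Fract p q \<le> Fract c d"
  shows "\<exists>n. Fract p q \<in> set (row x y n)"
  using assms
proof (induction "nat (q - (b + d))" arbitrary: a b c d n us vs rule: less_induct)
  case less
  note pos = less.prems(1-3) and det = less.prems(4) and row = less.prems(5)
    and lower = less.prems(6) and upper = less.prems(7)
  show ?case
  proof (cases "Fract p q = Fract a b \<or> Fract p q = Fract c d")
    case True
    then have "Fract p q \<in> set (row x y n)" by (auto simp: row)
    then show ?thesis ..
  next
    case False
    then have "Fract a b < Fract p q" "Fract p q < Fract c d"
      using lower upper by auto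
    then have "a * q < p * b" "p * d < c * q"
      using pos by simp_all
    then have le: "b + d \<le> q"
      using denominator_between pos det by blast
    have med: "mediant (Fract a b) (Fract c d) = Fract (a + c) (b + d)"
      using pos coprime_if_det_1[OF det] by (intro mediant_Fract) auto
    obtain us' vs'
      where split: "row x y (Suc n) = us' @ Fract a b # Fract (a + c) (b + d) # Fract c d # vs'"
      using insert_mediants_neighbours[of us "Fract a b" "Fract c d" vs] row med by auto
    \<comment> \<open>Strictness in the last two cases keeps the measure positive, so the truncating
      \<open>nat\<close> really decreases.\<close>
    consider "q = b + d" | "q > b + d" "Fract p q \<le> Fract (a + c) (b + d)"
      | "q > b + d" "Fract (a + c) (b + d) \<le> Fract p q"
      using le by linarith
    then show ?thesis
    proof cases
      case 1
      have "p = a + c"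
      proof -
        \<comment> \<open>Substituting \<open>q = b + d\<close> and then replacing 1 by the
          determinant pinches \<open>p - a - c\<close> between 0 and 0.\<close>
        have "b * (p - a) - a * d \<ge> 1" "d * (c - p) + c * b \<ge> 1"
          using \<open>a * q < p * b\<close> \<open>p * d < c * q\<close> 1 by (simp_all add: algebra_simps)
        then have "b * (p - a - c) \<ge> 0" "d * (p - a - c) \<le> 0"
          using det by (simp_all add: algebra_simps)
        then show ?thesis
          using pos by (simp add: zero_le_mult_iff mult_le_0_iff)
      qed
      then have "Fract p q \<in> set (row x y (Suc n))"
        unfolding split using 1 by simp
      then show ?thesis ..
    next
      case 2
      \<comment> \<open>The determinant of the left half is
        \<open>b * (a + c) - a * (b + d) = b * c - a * d\<close>; the right half is
        symmetric.\<close>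
      show ?thesis
        by (rule less.hyps[OF _ _ _ _ _ split])
          (use 2 pos det lower in \<open>auto simp: algebra_simps\<close>)
    next
      case 3
      have split': "row x y (Suc n) = (us' @ [Fract a b]) @ Fract (a + c) (b + d) # Fract c d # vs'"
        using split by simp
      show ?thesis
        by (rule less.hyps[OF _ _ _ _ _ split'])
          (use 3 pos det upper in \<open>auto simp: algebra_simps\<close>)
    qed
  qed
qed

theorem theorem3p1:
  fixes a b c d :: int
  assumes "b > 0" and "d > 0"
    and "a \<ge> 0" and "c \<ge> 0"
    and "coprime a b" and "coprime c d"
    and "b * c - a * d = 1"
  shows "\<forall>t \<in> {Fract a b .. Fract c d}. appears_in t (mediant_tree (Fract a b) (Fract c d))"
proof
  fix t assume t: "t \<in> {Fract a b .. Fract c d}"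
  obtain p q where pq: "t = Fract p q" "q > 0"
    by (cases t) auto
  have "row (Fract a b) (Fract c d) 0 = [] @ Fract a b # Fract c d # []"
    by simp
  then have "\<exists>n. Fract p q \<in> set (row (Fract a b) (Fract c d) n)"
    \<comment> \<open>Rotation puts the row equation first, so that the chained fact fixes the pair
      and its empty surroundings.\<close>
    by (rule appears_between_neighbours[rotated 4]) (use assms t pq in auto)
  then show "appears_in t (mediant_tree (Fract a b) (Fract c d))"
    unfolding appears_in_def mediant_tree_def pq(1) by blast
qed

end
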